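(* Let $A$ be an integral domain, $a$ a nonzero element of $A$, $(I_n)_{n\geq 0}$ an $a$-filtration of $A$, and $R:=\sum_{n\geq 0}a^{-n}I_n\subseteq A[a^{-1}]$. Let $p$ be a prime ideal of $A$ with $a\in p$. Then $p$ is the contraction to $A$ of a prime ideal of $R$ if and only if $a^{-n}pI_{n}\cap A=p$ for each $n\geq 0$. Moreover, if either condition holds, then $p\supseteq I_{1}$.
   Context: A filtration of a ring $A$ is a descending chain $A=I_0\supseteq I_1\supseteq I_2\supseteq\cdots$ of ideals of $A$ such that $I_nI_m\subseteq I_{n+m}$ for all $n,m\ge 0$. It is an $a$-filtration (for $a\in A$) if moreover $aI_n\subseteq I_{n+1}$ for every $n\geq 0$. For an ideal $J$ of the domain $A$ and $a\neq 0$, $a^{-n}J=\{a^{-n}x\mid x\in J\}$ inside the fraction field of $A$. For an $a$-filtration $(I_n)$, the set $R=\sum_{n\ge0}a^{-n}I_n$ is a ring with $A\subseteq R\subseteq A[a^{-1}]$, and it is the ascending union of the fractional ideals $a^{-n}I_n$. *)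

theory Defs
  imports
    "HOL-Algebra.Algebraic_Closure_Type"
    "HOL-Algebra.Ideal_Product"
    "HOL-Computational_Algebra.Polynomial_Factorial"
begin

text \<open>
  An integral domain \<open>A\<close> is a type \<open>'a :: idom\<close> and its fraction field is \<open>'a fract\<close>, in which
  \<open>A\<close> is identified with \<open>range to_fract\<close>.  The records \<open>ring_of_type_algebra\<close> make the
  notions of ideal, ideal product and prime ideal for explicit carriers available for \<open>A\<close> and for
  subrings of \<open>'a fract\<close>.
\<close>

definition ring_filtration :: "('r, 'm) ring_scheme \<Rightarrow> (nat \<Rightarrow> 'r set) \<Rightarrow> bool" where
  "ring_filtration A I \<longleftrightarrow>
     (\<forall>n. ideal (I n) A) \<and>
     I 0 = carrier A \<and>
     (\<forall>n. I (Suc n) \<subseteq> I n) \<and>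
     (\<forall>n m. ideal_prod A (I n) (I m) \<subseteq> I (n + m))"

definition a_filtration :: "('r, 'm) ring_scheme \<Rightarrow> 'r \<Rightarrow> (nat \<Rightarrow> 'r set) \<Rightarrow> bool" where
  "a_filtration A a I \<longleftrightarrow>
     ring_filtration A I \<and> (\<forall>n. \<forall>x\<in>I n. a \<otimes>\<^bsub>A\<^esub> x \<in> I (Suc n))"

text \<open>The fractional ideal \<open>a\<^sup>-\<^sup>n J\<close>; this is the intended object only for \<open>a \<noteq> 0\<close>.\<close>

definition inv_power_scale :: "'a::idom \<Rightarrow> nat \<Rightarrow> 'a set \<Rightarrow> 'a fract set" where
  "inv_power_scale a n J = (\<lambda>x. inverse (to_fract a ^ n) * to_fract x) ` J"

definition family_sum :: "(nat \<Rightarrow> 'b::comm_monoid_add set) \<Rightarrow> 'b set" where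
  "family_sum M = {\<Sum>n\<in>F. x n | F x. finite F \<and> (\<forall>n\<in>F. x n \<in> M n)}"

definition filtration_ring :: "'a::idom \<Rightarrow> (nat \<Rightarrow> 'a set) \<Rightarrow> 'a fract ring" where
  "filtration_ring a I =
     ring_of_type_algebra\<lparr>carrier := family_sum (\<lambda>n. inv_power_scale a n (I n))\<rparr>"

end

(*
  The extension pR is the ascending union of the fractional ideals a^{-n} p I_n, so the condition
  on the intersections says exactly that pR contracts to p.  A prime of R lying over p contains pR;
  conversely, if pR contracts to p, then pR misses the multiplicative set A - p, and any ideal of R
  that contains pR and is maximal with respect to missing A - p is a prime lying over p.
  For x in I_1 we have x = a^{-1} (a x) with a x in p I_1, so the case n = 1 puts x in p.
*)
theory Submission
  imports Defs
begin

section \<open>Prime ideals disjoint from a multiplicative set\<close>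

text \<open>Krull's argument: Zorn's lemma yields an ideal maximal among those that contain
  \<open>J\<close> and miss \<open>S\<close>, and maximality forces it to be prime. Keeping
  \<open>J\<close> inside is what later places the prime above the extension of
  \<open>p\<close>.\<close>

lemma (in cring) exists_primeideal_avoiding_submonoid:
  assumes S: "submonoid S R" and J: "ideal J R" and JS: "J \<inter> S = {}"
  shows "\<exists>Q. primeideal Q R \<and> J \<subseteq> Q \<and> Q \<inter> S = {}"
proof -
  define F where "F = {K. ideal K R \<and> J \<subseteq> K \<and> K \<inter> S = {}}"
  have "\<exists>M\<in>F. \<forall>N\<in>F. M \<subseteq> N \<longrightarrow> N = M"
  proof (rule subset_Zorn_nonempty)
    show "F \<noteq> {}" using J JS by (auto simp: F_def)
  next
    fix C assume "C \<noteq> {}" and C: "subset.chain F C"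
    \<comment> \<open>Forgetting the conditions on \<open>J\<close> and \<open>S\<close> leaves a
      chain of ideals, whose union is an ideal; both conditions then pass to the union of a nonempty
      chain.\<close>
    then have "subset.chain {I. ideal I R} C"
      unfolding pred_on.chain_def F_def by auto
    from chain_Union_is_ideal[OF this] \<open>C \<noteq> {}\<close> have "ideal (\<Union>C) R" by simp
    moreover have "C \<subseteq> F" using C unfolding pred_on.chain_def by blast
    ultimately show "\<Union>C \<in> F" using \<open>C \<noteq> {}\<close> unfolding F_def by blast
  qed
  then obtain Q where "Q \<in> F" and Q_max: "\<forall>N\<in>F. Q \<subseteq> N \<longrightarrow> N = Q" by blast
  then have Q: "ideal Q R" "J \<subseteq> Q" "Q \<inter> S = {}" by (auto simp: F_def)
  have max: "N = Q" if "ideal N R" "Q \<subseteq> N" "N \<inter> S = {}" for N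
    using Q_max that Q(2) by (auto simp: F_def)
  interpret Q: ideal Q R by (rule Q(1))
  \<comment> \<open>The ideal generated by \<open>Q\<close> and \<open>x\<close> is strictly larger
    than \<open>Q\<close>, so by maximality it meets \<open>S\<close>.\<close>
  have meets: "\<exists>q\<in>Q. \<exists>r\<in>carrier R. q \<oplus> r \<otimes> x \<in> S" if x: "x \<in> carrier R" "x \<notin> Q" for x
  proof -
    let ?N = "Q <+>\<^bsub>R\<^esub> PIdl x"
    have "ideal ?N R" using Q(1) cgenideal_ideal[OF x(1)] by (rule add_ideals)
    moreover have "Q \<subseteq> ?N"
    proof
      fix q assume "q \<in> Q"
      then have "q = q \<oplus> \<zero>" using Q.a_Hcarr by simp
      moreover have "\<zero> \<in> PIdl x"
        using cgenideal_ideal[OF x(1)] by (simp add: additive_subgroup.zero_closed ideal.axioms(1))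
      ultimately show "q \<in> ?N" using \<open>q \<in> Q\<close> unfolding set_add_def' by blast
    qed
    moreover have "x \<in> ?N"
    proof -
      have "x = \<zero> \<oplus> x" using x by simp
      then show ?thesis
        using cgenideal_self[OF x(1)] Q.zero_closed unfolding set_add_def' by blast
    qed
    ultimately have "?N \<inter> S \<noteq> {}" using max x(2) by metis
    then show ?thesis unfolding set_add_def' cgenideal_def by blast
  qed
  have "primeideal Q R"
  proof (rule primeidealI[OF Q(1) cring_axioms])
    show "carrier R \<noteq> Q" using submonoid.one_closed[OF S] Q(3) one_closed by blast
  next
    fix x y assume xy: "x \<in> carrier R" "y \<in> carrier R" "x \<otimes> y \<in> Q"
    show "x \<in> Q \<or> y \<in> Q"
    proof (rule ccontr)
      assume "\<not> (x \<in> Q \<or> y \<in> Q)"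
      then obtain q r q' r' where *: "q \<in> Q" "r \<in> carrier R" "q \<oplus> r \<otimes> x \<in> S"
        "q' \<in> Q" "r' \<in> carrier R" "q' \<oplus> r' \<otimes> y \<in> S"
        using meets xy by metis
      note c = *(2,5) xy(1,2) Q.a_Hcarr[OF *(1)] Q.a_Hcarr[OF *(4)]
      \<comment> \<open>The left side is a product of two elements of \<open>S\<close>. After
        expansion every summand has a factor \<open>q\<close>, \<open>q'\<close> or
        \<open>x \<otimes> y\<close> from \<open>Q\<close>, so the product lies in both
        \<open>S\<close> and \<open>Q\<close>.\<close>
      have "(q \<oplus> r \<otimes> x) \<otimes> (q' \<oplus> r' \<otimes> y)
          = q \<otimes> (q' \<oplus> r' \<otimes> y) \<oplus> (r \<otimes> x \<otimes> q' \<oplus> r \<otimes> r' \<otimes> (x \<otimes> y))"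
        using c by algebra
      moreover have "q \<otimes> (q' \<oplus> r' \<otimes> y) \<in> Q" "r \<otimes> x \<otimes> q' \<in> Q" "r \<otimes> r' \<otimes> (x \<otimes> y) \<in> Q"
        using * xy(3) c by (simp_all add: Q.I_l_closed Q.I_r_closed)
      ultimately show False
        using submonoid.m_closed[OF S *(3,6)] Q(3) Q.a_closed by auto
    qed
  qed
  with Q show ?thesis by blast
qed

section \<open>Type-class rings and their subrings as records\<close>

lemma ring_of_type_algebra_simps [simp]:
  "carrier ring_of_type_algebra = UNIV"
  "x \<otimes>\<^bsub>ring_of_type_algebra\<^esub> y = x * y"
  "x \<oplus>\<^bsub>ring_of_type_algebra\<^esub> y = x + y"
  "\<one>\<^bsub>ring_of_type_algebra\<^esub> = 1"
  "\<zero>\<^bsub>ring_of_type_algebra\<^esub> = 0"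
  by (simp_all add: ring_of_type_algebra_def)

lemma a_inv_ring_of_type_algebra [simp]:
  "\<ominus>\<^bsub>ring_of_type_algebra\<^esub> x = - (x :: 'a::comm_ring_1)"
proof -
  interpret ring "ring_of_type_algebra :: 'a ring" by (rule ring_from_type_algebra)
  show ?thesis by (rule minus_equality) auto
qed

lemma ideal_ring_of_type_algebraD:
  fixes J :: "'a::comm_ring_1 set"
  assumes "ideal J ring_of_type_algebra"
  shows "0 \<in> J"
    and "\<And>x y. x \<in> J \<Longrightarrow> y \<in> J \<Longrightarrow> x + y \<in> J"
    and "\<And>x. x \<in> J \<Longrightarrow> - x \<in> J"
    and "\<And>x y. x \<in> J \<Longrightarrow> y * x \<in> J"
proof -
  note J = ideal.axioms(1)[OF assms]
  show "0 \<in> J" using additive_subgroup.zero_closed[OF J]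
    by (simp only: ring_of_type_algebra_simps)
  show "x + y \<in> J" if "x \<in> J" "y \<in> J" for x y using additive_subgroup.a_closed[OF J that] by simp
  show "- x \<in> J" if "x \<in> J" for x using additive_subgroup.a_inv_closed[OF J that] by simp
  show "y * x \<in> J" if "x \<in> J" for x y using ideal.I_l_closed[OF assms that, of y] by simp
qed

lemma cring_subring_of_type_algebra:
  fixes K :: "'a::comm_ring_1 set"
  assumes "1 \<in> K" "\<And>x. x \<in> K \<Longrightarrow> - x \<in> K"
    "\<And>x y. x \<in> K \<Longrightarrow> y \<in> K \<Longrightarrow> x * y \<in> K" "\<And>x y. x \<in> K \<Longrightarrow> y \<in> K \<Longrightarrow> x + y \<in> K"
  shows "cring (ring_of_type_algebra\<lparr>carrier := K\<rparr>)"
proof -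
  interpret cring "ring_of_type_algebra :: 'a ring" by (rule cring_from_type_algebra)
  have "subring K ring_of_type_algebra"
    by (rule subringI) (use assms in auto)
  then show ?thesis using subcring_iff[of K] subcringI' by simp
qed

lemma ideal_subring_of_type_algebraI:
  fixes K :: "'a::comm_ring_1 set"
  assumes K: "cring (ring_of_type_algebra\<lparr>carrier := K\<rparr>)"
    and "Q \<subseteq> K" "0 \<in> Q" "\<And>x y. x \<in> Q \<Longrightarrow> y \<in> Q \<Longrightarrow> x + y \<in> Q" "\<And>x. x \<in> Q \<Longrightarrow> - x \<in> Q"
    and "\<And>x y. x \<in> Q \<Longrightarrow> y \<in> K \<Longrightarrow> y * x \<in> Q"
  shows "ideal Q (ring_of_type_algebra\<lparr>carrier := K\<rparr>)" (is "ideal Q ?K")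
proof -
  interpret K: cring ?K by fact
  \<comment> \<open>The record's additive inverse is taken relative to the carrier \<open>K\<close>;
    uniqueness of inverses identifies it with the negation of the type.\<close>
  have inv: "\<ominus>\<^bsub>?K\<^esub> x = - x" if "x \<in> Q" for x
    using assms that by (intro K.minus_equality) auto
  show ?thesis
  proof (rule idealI[OF K.ring_axioms])
    show "subgroup Q (add_monoid ?K)"
      by (rule K.add.subgroupI) (use assms inv in \<open>auto simp flip: a_inv_def\<close>)
  qed (use assms in \<open>auto simp: mult.commute\<close>)
qed

section \<open>Fractional ideals and their ascending union\<close>

lemma mem_inv_power_scale_iff:
  assumes "a \<noteq> 0"
  shows "x \<in> inv_power_scale a n J \<longleftrightarrow> (\<exists>y\<in>J. to_fract a ^ n * x = to_fract y)"
  using assms by (auto simp: inv_power_scale_def image_iff field_simps)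

lemma to_fract_power: "to_fract (x ^ n) = to_fract x ^ n"
  by (induction n) auto

text \<open>One step up rewrites \<open>a^(-n) y\<close> as \<open>a^(-(n+1)) (a y)\<close>. The
  family \<open>J\<close> is left general because both \<open>I n\<close> and the products of
  \<open>p\<close> with \<open>I n\<close> are substituted for it.\<close>

lemma inv_power_scale_mono:
  assumes a: "a \<noteq> 0" and J: "\<And>n x. x \<in> J n \<Longrightarrow> a * x \<in> J (Suc n)" and "m \<le> n"
  shows "inv_power_scale a m (J m) \<subseteq> inv_power_scale a n (J n)"
  using \<open>m \<le> n\<close>
proof (induction n rule: dec_induct)
  case (step n)
  have "inv_power_scale a n (J n) \<subseteq> inv_power_scale a (Suc n) (J (Suc n))"
  proof
    fix x assume "x \<in> inv_power_scale a n (J n)"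
    then obtain y where "y \<in> J n" "to_fract a ^ n * x = to_fract y"
      using mem_inv_power_scale_iff[OF a] by blast
    then have "a * y \<in> J (Suc n)" "to_fract a ^ Suc n * x = to_fract (a * y)"
      using J by auto
    then show "x \<in> inv_power_scale a (Suc n) (J (Suc n))"
      using mem_inv_power_scale_iff[OF a] by blast
  qed
  with step.IH show ?case by blast
qed simp

lemma inv_power_scale_zero: "0 \<in> J \<Longrightarrow> 0 \<in> inv_power_scale a n J"
  by (force simp: inv_power_scale_def)

lemma inv_power_scale_add:
  assumes "\<And>x y. x \<in> J \<Longrightarrow> y \<in> J \<Longrightarrow> x + y \<in> J"
    and "x \<in> inv_power_scale a n J" "y \<in> inv_power_scale a n J"
  shows "x + y \<in> inv_power_scale a n J"
  using assms unfolding inv_power_scale_def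
  by (auto simp: image_iff simp flip: distrib_left to_fract_add)

lemma inv_power_scale_uminus:
  assumes "\<And>x. x \<in> J \<Longrightarrow> - x \<in> J" and "x \<in> inv_power_scale a n J"
  shows "- x \<in> inv_power_scale a n J"
  using assms unfolding inv_power_scale_def
  by (auto simp: image_iff simp flip: mult_minus_right to_fract_uminus)

lemma inv_power_scale_mult:
  assumes "\<And>x y. x \<in> J \<Longrightarrow> y \<in> K \<Longrightarrow> x * y \<in> L"
    and "x \<in> inv_power_scale a m J" "y \<in> inv_power_scale a n K"
  shows "x * y \<in> inv_power_scale a (m + n) L"
proof -
  from assms(2,3) obtain u v where "u \<in> J" "v \<in> K"
    "x = inverse (to_fract a ^ m) * to_fract u" "y = inverse (to_fract a ^ n) * to_fract v"
    by (auto simp: inv_power_scale_def)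
  then have "x * y = inverse (to_fract a ^ (m + n)) * to_fract (u * v)" "u * v \<in> L"
    using assms(1) by (auto simp: power_add)
  then show ?thesis unfolding inv_power_scale_def by blast
qed

text \<open>Since the chain ascends, both summands already lie in the term of index
  \<open>max m n\<close>, which is closed under addition.\<close>

lemma Union_inv_power_scale_add:
  assumes a: "a \<noteq> 0" and J: "\<And>n x. x \<in> J n \<Longrightarrow> a * x \<in> J (Suc n)"
    and add: "\<And>n x y. x \<in> J n \<Longrightarrow> y \<in> J n \<Longrightarrow> x + y \<in> J n"
    and x: "x \<in> (\<Union>n. inv_power_scale a n (J n))" and y: "y \<in> (\<Union>n. inv_power_scale a n (J n))"
  shows "x + y \<in> (\<Union>n. inv_power_scale a n (J n))"
proof -
  from x y obtain m n where
    "x \<in> inv_power_scale a m (J m)" "y \<in> inv_power_scale a n (J n)" by blast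
  then have "x \<in> inv_power_scale a (max m n) (J (max m n))"
    "y \<in> inv_power_scale a (max m n) (J (max m n))"
    using inv_power_scale_mono[of a J, OF a J] by (meson max.cobounded1 max.cobounded2 subsetD)+
  then show ?thesis using inv_power_scale_add[of "J (max m n)", OF add] by blast
qed

text \<open>A finite sum collapses into a single term of the ascending chain, so \<open>R\<close>
  can be handled as a union instead of through sums.\<close>

lemma family_sum_inv_power_scale:
  assumes a: "a \<noteq> 0" and J: "\<And>n x. x \<in> J n \<Longrightarrow> a * x \<in> J (Suc n)"
    and zero: "0 \<in> J 0" and add: "\<And>n x y. x \<in> J n \<Longrightarrow> y \<in> J n \<Longrightarrow> x + y \<in> J n"
  shows "family_sum (\<lambda>n. inv_power_scale a n (J n)) = (\<Union>n. inv_power_scale a n (J n))"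
    (is "?S = ?U")
proof
  show "?S \<subseteq> ?U"
  proof
    fix s assume "s \<in> ?S"
    then obtain F x where F: "finite F" "\<forall>n\<in>F. x n \<in> inv_power_scale a n (J n)" and "s = sum x F"
      by (auto simp: family_sum_def)
    from F have "sum x F \<in> ?U"
    proof (induction F rule: finite_induct)
      case empty
      \<comment> \<open>The empty sum is 0, which is placed in degree 0.\<close>
      then show ?case using inv_power_scale_zero[OF zero] by auto
    next
      case (insert n F)
      then have "x n + sum x F \<in> ?U"
        using Union_inv_power_scale_add[of a J, OF a J add] by auto
      with insert show ?case by simp
    qed
    with \<open>s = sum x F\<close> show "s \<in> ?U" by simp
  qed
next
  show "?U \<subseteq> ?S"
  proof
    fix s assume "s \<in> ?U"
    then obtain n where "s \<in> inv_power_scale a n (J n)" by blast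
    then have "s = (\<Sum>i\<in>{n}. s)" "finite {n}" "\<forall>i\<in>{n}. s \<in> inv_power_scale a i (J i)" by auto
    then show "s \<in> ?S" unfolding family_sum_def by blast
  qed
qed

text \<open>In a sum of products \<open>i * j\<close>, the factor \<open>c\<close> is absorbed by
  each \<open>j\<close>. It serves with \<open>c = a\<close>, to make the products of
  \<open>p\<close> with \<open>I n\<close> a family stable under the shift, and with
  \<open>c\<close> in \<open>I m\<close>, to raise the degree by \<open>m\<close>.\<close>

lemma ideal_prod_shift:
  fixes p :: "'a::comm_ring_1 set"
  assumes "\<And>y. y \<in> J \<Longrightarrow> c * y \<in> K"
    and "x \<in> ideal_prod ring_of_type_algebra p J"
  shows "c * x \<in> ideal_prod ring_of_type_algebra p K"
  using assms(2)
proof (induction rule: ideal_prod.induct)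
  case (prod i j)
  then have "i \<otimes>\<^bsub>ring_of_type_algebra\<^esub> (c * j) \<in> ideal_prod ring_of_type_algebra p K"
    using assms(1) by (intro ideal_prod.prod)
  then show ?case by (simp add: mult.left_commute)
next
  case (sum s t)
  then have "c * s \<oplus>\<^bsub>ring_of_type_algebra\<^esub> c * t \<in> ideal_prod ring_of_type_algebra p K"
    by (intro ideal_prod.sum)
  then show ?case by (simp add: distrib_left)
qed

section \<open>The ring of an a-filtration\<close>

locale a_filtered_domain =
  fixes a :: "'a::idom" and I :: "nat \<Rightarrow> 'a set"
  assumes a_nonzero: "a \<noteq> 0" and filt: "a_filtration ring_of_type_algebra a I"
begin

lemma ideal_I: "ideal (I n) ring_of_type_algebra"
  using filt by (simp add: a_filtration_def ring_filtration_def)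

lemmas I_closed = ideal_ring_of_type_algebraD[OF ideal_I]

lemma I_0: "I 0 = UNIV"
  using filt by (simp add: a_filtration_def ring_filtration_def)

lemma I_shift: "x \<in> I n \<Longrightarrow> a * x \<in> I (Suc n)"
  using filt by (simp add: a_filtration_def)

lemma I_mult:
  assumes "x \<in> I m" "y \<in> I n"
  shows "x * y \<in> I (m + n)"
proof -
  have "ideal_prod ring_of_type_algebra (I m) (I n) \<subseteq> I (m + n)"
    using filt unfolding a_filtration_def ring_filtration_def by blast
  then show ?thesis
    using ideal_prod.prod[OF assms, of ring_of_type_algebra] by auto
qed

text \<open>Starting from 1 in \<open>I 0\<close>, each factor \<open>a\<close> raises the degree by
  one. This supplies the numerators needed to write elements of \<open>p\<close> with denominator
  \<open>a ^ n\<close>.\<close>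

lemma a_power_mem: "a ^ n \<in> I n"
  by (induction n) (use I_0 I_shift in auto)

lemma carrier_filtration_ring:
  "carrier (filtration_ring a I) = (\<Union>n. inv_power_scale a n (I n))"
  using family_sum_inv_power_scale[OF a_nonzero, of I] I_shift I_closed(1,2)
  by (simp add: filtration_ring_def)

lemma filtration_ring_eq:
  "filtration_ring a I = ring_of_type_algebra\<lparr>carrier := \<Union>n. inv_power_scale a n (I n)\<rparr>"
  using carrier_filtration_ring by (simp add: filtration_ring_def)

lemma filtration_ring_simps:
  "x \<otimes>\<^bsub>filtration_ring a I\<^esub> y = x * y"
  "x \<oplus>\<^bsub>filtration_ring a I\<^esub> y = x + y"
  "\<one>\<^bsub>filtration_ring a I\<^esub> = 1"
  by (simp_all add: filtration_ring_def)

lemma to_fract_mem_filtration_ring: "to_fract x \<in> carrier (filtration_ring a I)"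
proof -
  have "to_fract x \<in> inv_power_scale a 0 (I 0)"
    by (simp add: inv_power_scale_def I_0)
  then show ?thesis by (auto simp: carrier_filtration_ring)
qed

text \<open>The unit sits in degree 0, products use that degrees add under multiplication, and sums
  use that the chain ascends.\<close>

lemma cring_filtration_ring: "cring (filtration_ring a I)"
  unfolding filtration_ring_eq
proof (rule cring_subring_of_type_algebra)
  let ?U = "\<Union>n. inv_power_scale a n (I n)"
  show "1 \<in> ?U" using to_fract_mem_filtration_ring[of 1] by (simp add: carrier_filtration_ring)
  show "- x \<in> ?U" if "x \<in> ?U" for x
    using that by (auto intro: inv_power_scale_uminus I_closed(3))
  show "x * y \<in> ?U" if "x \<in> ?U" "y \<in> ?U" for x y
    using that by (blast intro: inv_power_scale_mult I_mult)
  show "x + y \<in> ?U" if "x \<in> ?U" "y \<in> ?U" for x y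
    by (rule Union_inv_power_scale_add[OF a_nonzero I_shift I_closed(2) that])
qed

section \<open>Extension to the ring and contraction back\<close>

text \<open>This union is the extension \<open>pR\<close>. It absorbs multiplication by
  \<open>R\<close> because an element of \<open>I m\<close> times one of \<open>p I n\<close> lies
  in \<open>p I (m + n)\<close>.\<close>

lemma ideal_extension:
  assumes p: "ideal p ring_of_type_algebra"
  shows "ideal (\<Union>n. inv_power_scale a n (ideal_prod ring_of_type_algebra p (I n)))
           (filtration_ring a I)" (is "ideal ?E _")
proof -
  interpret A: ring "ring_of_type_algebra :: 'a ring" by (rule ring_from_type_algebra)
  let ?P = "\<lambda>n. ideal_prod ring_of_type_algebra p (I n)"
  have P: "ideal (?P n) ring_of_type_algebra" for n
    by (rule A.ideal_prod_is_ideal[OF p ideal_I])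
  note P_closed = ideal_ring_of_type_algebraD[OF P]
  show ?thesis unfolding filtration_ring_eq
  proof (rule ideal_subring_of_type_algebraI)
    show "cring (ring_of_type_algebra\<lparr>carrier := \<Union>n. inv_power_scale a n (I n)\<rparr>)"
      using cring_filtration_ring by (simp add: filtration_ring_eq)
    show "?E \<subseteq> (\<Union>n. inv_power_scale a n (I n))"
      using A.ideal_prod_inter[OF p ideal_I] unfolding inv_power_scale_def by blast
    show "0 \<in> ?E" using inv_power_scale_zero[OF P_closed(1)] by blast
    show "x + y \<in> ?E" if "x \<in> ?E" "y \<in> ?E" for x y
      using that by (intro Union_inv_power_scale_add[OF a_nonzero]) (auto intro: P_closed ideal_prod_shift I_shift)
    show "- x \<in> ?E" if "x \<in> ?E" for x
      using that inv_power_scale_uminus[OF P_closed(3)] by blast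
    fix x y assume "x \<in> ?E" "y \<in> (\<Union>n. inv_power_scale a n (I n))"
    then obtain m n where mn: "y \<in> inv_power_scale a m (I m)" "x \<in> inv_power_scale a n (?P n)"
      by blast
    have "u * v \<in> ?P (m + n)" if "u \<in> I m" "v \<in> ?P n" for u v
      using ideal_prod_shift[OF _ that(2)] I_mult[OF that(1)] by blast
    from inv_power_scale_mult[OF this mn] show "y * x \<in> ?E" by blast
  qed
qed

text \<open>Write \<open>x\<close> as \<open>a^(-n) (x a^n)\<close> with \<open>a ^ n\<close> in
  \<open>I n\<close>. Hence one inclusion of the intersection condition is automatic in every
  degree, and its content is the reverse inclusion.\<close>

lemma to_fract_mem_extension:
  assumes "x \<in> p"
  shows "to_fract x \<in> inv_power_scale a n (ideal_prod ring_of_type_algebra p (I n))"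
proof -
  have "x * a ^ n \<in> ideal_prod ring_of_type_algebra p (I n)"
    using ideal_prod.prod[OF assms a_power_mem, of ring_of_type_algebra] by simp
  then show ?thesis
    by (auto simp: mem_inv_power_scale_iff[OF a_nonzero] to_fract_power intro!: bexI[of _ "x * a ^ n"])
qed

text \<open>This is the minimality of \<open>pR\<close>: any ideal of \<open>R\<close> containing
  \<open>p\<close> contains each term of the union.\<close>

lemma extension_subset:
  assumes Q: "ideal Q (filtration_ring a I)" and pQ: "to_fract ` p \<subseteq> Q"
  shows "inv_power_scale a n (ideal_prod ring_of_type_algebra p (I n)) \<subseteq> Q"
proof -
  have "inverse (to_fract a ^ n) * to_fract x \<in> Q"
    if "x \<in> ideal_prod ring_of_type_algebra p (I n)" for x
    using that
  proof (induction rule: ideal_prod.induct)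
    case (prod i j)
    \<comment> \<open>The denominator is attached to \<open>j\<close> in \<open>I n\<close>, which
      gives an element of \<open>R\<close>; multiplying it by \<open>i\<close> from \<open>p\<close>
      stays in \<open>Q\<close>.\<close>
    have "inverse (to_fract a ^ n) * to_fract j \<in> carrier (filtration_ring a I)"
      using prod by (auto simp: carrier_filtration_ring inv_power_scale_def)
    from ideal.I_l_closed[OF Q _ this, of "to_fract i"] prod pQ show ?case
      by (auto simp: filtration_ring_simps mult_ac)
  next
    case (sum s t)
    then show ?case
      using additive_subgroup.a_closed[OF ideal.axioms(1)[OF Q] sum.IH]
      by (simp add: filtration_ring_simps distrib_left)
  qed
  then show ?thesis by (auto simp: inv_power_scale_def)
qed

lemma contraction_iff:
  assumes p: "primeideal p ring_of_type_algebra"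
  shows "(\<exists>Q. primeideal Q (filtration_ring a I) \<and> to_fract -` Q = p) \<longleftrightarrow>
    (\<forall>n. inv_power_scale a n (ideal_prod ring_of_type_algebra p (I n)) \<inter> range to_fract
           = to_fract ` p)" (is "?L \<longleftrightarrow> ?R")
proof
  assume ?L
  then obtain Q where Q: "ideal Q (filtration_ring a I)" and c: "to_fract -` Q = p"
    using primeideal.axioms(1) by blast
  from c have "to_fract ` p \<subseteq> Q" by blast
  \<comment> \<open>Each term is squeezed between the image of \<open>p\<close> and
    \<open>Q\<close>, and \<open>Q\<close> meets the image of the domain only in that of
    \<open>p\<close>.\<close>
  from extension_subset[OF Q this] to_fract_mem_extension[where p = p] c show ?R by blast
next
  assume R: ?R
  interpret p: primeideal p "ring_of_type_algebra :: 'a ring" by fact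
  interpret B: cring "filtration_ring a I" by (rule cring_filtration_ring)
  let ?E = "\<Union>n. inv_power_scale a n (ideal_prod ring_of_type_algebra p (I n))"
  have "1 \<notin> p" using p.one_imp_carrier p.I_notcarr by auto
  moreover have "x * y \<notin> p" if "x \<notin> p" "y \<notin> p" for x y
    using p.I_prime[of x y] that by auto
  ultimately have "submonoid (to_fract ` (- p)) (filtration_ring a I)"
    using to_fract_mem_filtration_ring
    by unfold_locales (auto simp: filtration_ring_simps simp flip: to_fract_mult to_fract_1)
  \<comment> \<open>A common element would lie in one term of the union, so \<open>R\<close> would
    put it in the image of \<open>p\<close>; injectivity of \<open>to_fract\<close> excludes
    this.\<close>
  moreover have "?E \<inter> to_fract ` (- p) = {}"
    using R by (fastforce dest: equalityD1)
  ultimately have "\<exists>Q. primeideal Q (filtration_ring a I) \<and> ?E \<subseteq> Q \<and> Q \<inter> to_fract ` (- p) = {}"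
    by (intro B.exists_primeideal_avoiding_submonoid ideal_extension p.ideal_axioms)
  then obtain Q where Q: "primeideal Q (filtration_ring a I)" "?E \<subseteq> Q"
    "Q \<inter> to_fract ` (- p) = {}" by (elim exE conjE)
  \<comment> \<open>The extension inside \<open>Q\<close> gives the inclusion of \<open>p\<close>;
    disjointness from the image of the complement gives the other one.\<close>
  have "to_fract -` Q = p"
    using Q(2,3) to_fract_mem_extension[where p = p] by blast
  with Q(1) show ?L by blast
qed

text \<open>The condition enters only in degree 1 and only through the inclusion that is not
  automatic.\<close>

lemma I_1_subset:
  assumes "a \<in> p"
    and "inv_power_scale a 1 (ideal_prod ring_of_type_algebra p (I 1)) \<inter> range to_fract \<subseteq> to_fract ` p"
  shows "I 1 \<subseteq> p"
proof
  fix x assume "x \<in> I 1"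
  then have "a * x \<in> ideal_prod ring_of_type_algebra p (I 1)"
    using ideal_prod.prod[OF assms(1), of x "I 1" ring_of_type_algebra] by simp
  then have "to_fract x \<in> inv_power_scale a 1 (ideal_prod ring_of_type_algebra p (I 1))"
    by (auto simp: mem_inv_power_scale_iff[OF a_nonzero] intro!: bexI[of _ "a * x"])
  then show "x \<in> p" using assms(2) by auto
qed

end

theorem corollary2p4:
  fixes a :: "'a::idom" and I :: "nat \<Rightarrow> 'a set" and p :: "'a set"
  defines "A \<equiv> (ring_of_type_algebra :: 'a ring)"
    and "R \<equiv> filtration_ring a I"
  assumes "a \<noteq> 0"
    and "a_filtration A a I"
    and "primeideal p A"
    and "a \<in> p"
  shows "((\<exists>Q. primeideal Q R \<and> to_fract -` Q = p) \<longleftrightarrow>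
           (\<forall>n. inv_power_scale a n (ideal_prod A p (I n)) \<inter> range to_fract = to_fract ` p)) \<and>
         ((\<exists>Q. primeideal Q R \<and> to_fract -` Q = p) \<or>
           (\<forall>n. inv_power_scale a n (ideal_prod A p (I n)) \<inter> range to_fract = to_fract ` p)
          \<longrightarrow> I 1 \<subseteq> p)"
proof -
  interpret a_filtered_domain a I
    by unfold_locales (use assms in auto)
  have p: "primeideal p ring_of_type_algebra" using assms by simp
  \<comment> \<open>Deriving the last claim from the intersection condition suffices, as
    \<open>contraction_iff\<close> reduces the other disjunct to it.\<close>
  have "(\<forall>n. inv_power_scale a n (ideal_prod A p (I n)) \<inter> range to_fract = to_fract ` p)
          \<Longrightarrow> I 1 \<subseteq> p"
    unfolding A_def by (rule I_1_subset[OF \<open>a \<in> p\<close>]) blast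
  then show ?thesis
    using contraction_iff[OF p] unfolding A_def R_def by blast
qed

end
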